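(* Let $s\geq 0$ be an integer and let $P\subset\mathbb{R}^d$ be a $d$-dimensional lattice polytope of degree at most $s$, with $f^*$-vector $(f^*_0,\dots,f^*_d)$. Then, unless the degree of $P$ is $0$, we have $f^*_{k-1}>f^*_k$ for all integers $k$ with $\lceil \frac{d+s}{2}\rceil\leq k\leq d$.
   Context: A lattice polytope is the convex hull of finitely many points of $\mathbb{Z}^d$. For a $d$-dimensional lattice polytope $P\subset\mathbb{R}^d$ and a positive integer $n$, let $\operatorname{ehr}_P(n)=|nP\cap\mathbb{Z}^d|$ (a polynomial in $n$ of degree $d$). The $f^*$-vector $(f^*_0,\dots,f^*_d)$ is defined by $\operatorname{ehr}_P(n)=\sum_{k=0}^d f^*_k\binom{n-1}{k}$ for all positive integers $n$, and the $h^*$-vector $(h^*_0,\dots,h^*_d)$ by $\operatorname{ehr}_P(n)=\sum_{k=0}^d h^*_k\binom{n+d-k}{d}$ for all positive integers $n$. The degree of $P$ is the degree of the polynomial $\sum_{k=0}^d h^*_k z^k$, i.e. the largest $k$ with $h^*_k\neq 0$. *)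

theory Defs
  imports "HOL-Analysis.Analysis" "HOL-Computational_Algebra.Polynomial"
begin

definition lattice_points :: "(real ^ 'd) set" where
  "lattice_points = {x. \<forall>i. x $ i \<in> \<int>}"

definition lattice_polytope :: "(real ^ 'd) set \<Rightarrow> bool" where
  "lattice_polytope P \<longleftrightarrow> (\<exists>V. finite V \<and> V \<subseteq> lattice_points \<and> P = convex hull V)"

definition ehr :: "(real ^ 'd) set \<Rightarrow> nat \<Rightarrow> nat" where
  "ehr P n = card ((\<lambda>x. real n *\<^sub>R x) ` P \<inter> lattice_points)"

text \<open>
  The two vectors are the unique coefficient sequences in their defining identities, for a polytope
  of full dimension \<open>d = CARD('d)\<close>.  Entries with index above \<open>d\<close> are set to zero, so that \<open>THE\<close>
  picks out a single function on the naturals.  The natural-number subtractions do not truncate,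
  because \<open>n \<ge> 1\<close> and \<open>k \<le> d\<close>.
\<close>

definition fstar :: "(real ^ 'd) set \<Rightarrow> nat \<Rightarrow> real" where
  "fstar P = (THE f. (\<forall>k > CARD('d). f k = 0) \<and>
     (\<forall>n \<ge> 1. real (ehr P n) = (\<Sum>k\<le>CARD('d). f k * real ((n - 1) choose k))))"

definition hstar :: "(real ^ 'd) set \<Rightarrow> nat \<Rightarrow> real" where
  "hstar P = (THE h. (\<forall>k > CARD('d). h k = 0) \<and>
     (\<forall>n \<ge> 1. real (ehr P n) = (\<Sum>k\<le>CARD('d). h k * real ((n + CARD('d) - k) choose CARD('d)))))"

definition hstar_poly :: "(real ^ 'd) set \<Rightarrow> real poly" where
  "hstar_poly P = (\<Sum>k\<le>CARD('d). monom (hstar P k) k)"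

definition polytope_degree :: "(real ^ 'd) set \<Rightarrow> nat" where
  "polytope_degree P = degree (hstar_poly P)"

end

theory Submission imports Defs begin

text \<open>
  Expanding \<open>binomial (n + d - j) d\<close> by Vandermonde's identity gives
  \<open>f*_k = (\<Sum>j\<le>d. h*_j * binomial (d + 1 - j) (d - k))\<close>. For \<open>j \<le> s\<close> and \<open>2 * k \<ge> d + s\<close> the
  binomial coefficient does not decrease when \<open>k\<close> is replaced by \<open>k - 1\<close>, and for \<open>j = 0\<close> it
  increases. So it suffices that \<open>h*\<close> exists, is nonnegative and has \<open>h*_0 > 0\<close>. For this the
  cone over \<open>P\<close> is cut into half-open simplicial cones with generators at height 1: a regular
  triangulation comes from the optimal bases of a linear program with generic cost, and a generic
  point of the cone decides which facets to remove. A lattice point of a half-open simplicial cone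
  is uniquely a point of the fundamental box plus a natural combination of the generators, so
  \<open>h*_j\<close> counts the box points at height \<open>j\<close>.
\<close>

section \<open>Generic weights and the counting of weak compositions\<close>

text \<open>Weights \<open>t ^ f v\<close> with distinct exponents turn each nonzero linear form in
  \<open>F\<close> into a nonzero polynomial in t. The finitely many polynomials have finitely many
  roots altogether, so some positive t avoids them all.\<close>

lemma generic_weights:
  fixes F :: "('a \<Rightarrow> real) set"
  assumes "finite V" "finite F" and nz: "\<forall>\<alpha>\<in>F. \<exists>v\<in>V. \<alpha> v \<noteq> 0"
  shows "\<exists>c. (\<forall>v. 0 < c v) \<and> (\<forall>\<alpha>\<in>F. (\<Sum>v\<in>V. \<alpha> v * c v) \<noteq> 0)"
proof -
  obtain f :: "'a \<Rightarrow> nat" where f: "inj_on f V"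
    using finite_imp_inj_to_nat_seg[OF \<open>finite V\<close>] by blast
  define p where "p \<alpha> = (\<Sum>v\<in>V. monom (\<alpha> v) (f v))" for \<alpha> :: "'a \<Rightarrow> real"
  have p0: "p \<alpha> \<noteq> 0" if "\<alpha> \<in> F" for \<alpha>
  proof -
    obtain v where v: "v \<in> V" "\<alpha> v \<noteq> 0" using nz \<open>\<alpha> \<in> F\<close> by blast
    have "coeff (p \<alpha>) (f v) = (\<Sum>w\<in>V. if w = v then \<alpha> w else 0)"
      unfolding p_def coeff_sum using f v by (intro sum.cong) (auto simp: inj_on_eq_iff)
    then show ?thesis using v \<open>finite V\<close> by (auto simp: p_def)
  qed
  have "finite (\<Union>\<alpha>\<in>F. {t. poly (p \<alpha>) t = 0})"
    using p0 \<open>finite F\<close> by (auto intro: poly_roots_finite)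
  then have "\<not> {0<..} \<subseteq> (\<Union>\<alpha>\<in>F. {t. poly (p \<alpha>) t = 0})"
    using infinite_Ioi finite_subset by blast
  then obtain t where t: "t > 0" "\<And>\<alpha>. \<alpha> \<in> F \<Longrightarrow> poly (p \<alpha>) t \<noteq> 0" by auto
  show ?thesis
  proof (intro exI[of _ "\<lambda>v. t ^ f v"] conjI ballI)
    show "(\<Sum>v\<in>V. \<alpha> v * t ^ f v) \<noteq> 0" if "\<alpha> \<in> F" for \<alpha>
      using t(2)[OF that] by (simp add: p_def poly_sum poly_monom)
  qed (use t in simp)
qed

text \<open>Stars and bars: an enumeration of \<open>B\<close> turns the functions, fixed outside
  \<open>B\<close> by \<open>PiE\<close>, into lists of length \<open>card B\<close> with sum n.
  Nonemptiness of \<open>B\<close> gives \<open>n \<le> n + card B - 1\<close>, as the passage to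
  the complementary binomial coefficient requires.\<close>

lemma card_weak_compositions:
  assumes "finite B" "B \<noteq> {}"
  shows "card {m \<in> B \<rightarrow>\<^sub>E (UNIV :: nat set). sum m B = n} = (n + card B - 1) choose (card B - 1)"
proof -
  define D where "D = card B"
  obtain h where h: "bij_betw h {..<D} B"
    using ex_bij_betw_nat_finite[OF \<open>finite B\<close>] by (auto simp: D_def atLeast0LessThan)
  define g where "g = the_inv_into {..<D} h"
  have gh: "g (h i) = i" if "i < D" for i
    using that h by (auto simp: g_def bij_betw_def intro: the_inv_into_f_f)
  have hg: "h (g b) = b" "g b < D" if "b \<in> B" for b
    using that h f_the_inv_into_f_bij_betw[OF h] the_inv_into_into[of h "{..<D}" b "{..<D}"]
    by (auto simp: g_def bij_betw_def)
  have hB: "h i \<in> B" if "i < D" for i using that h by (auto simp: bij_betw_def)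
  have "bij_betw (\<lambda>m. map (m \<circ> h) [0..<D]) {m \<in> B \<rightarrow>\<^sub>E (UNIV :: nat set). sum m B = n}
          {l. length l = D \<and> sum_list l = n}"
  proof (rule bij_betw_byWitness[where f' = "\<lambda>l. restrict (\<lambda>b. l ! g b) B"])
    show "\<forall>m\<in>{m \<in> B \<rightarrow>\<^sub>E (UNIV :: nat set). sum m B = n}.
            restrict (\<lambda>b. map (m \<circ> h) [0..<D] ! g b) B = m"
      using hg by (auto simp: PiE_def extensional_def restrict_def fun_eq_iff)
    show "\<forall>l\<in>{l. length l = D \<and> sum_list l = n}.
            map (restrict (\<lambda>b. l ! g b) B \<circ> h) [0..<D] = l"
      using gh hB by (auto intro!: nth_equalityI)
    have "(\<Sum>i\<leftarrow>[0..<D]. m (h i)) = sum m B" for m :: "_ \<Rightarrow> nat"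
      using sum.reindex_bij_betw[OF h, of m] by (simp add: interv_sum_list_conv_sum_set_nat atLeast0LessThan)
    then show "(\<lambda>m. map (m \<circ> h) [0..<D]) ` {m \<in> B \<rightarrow>\<^sub>E (UNIV :: nat set). sum m B = n}
        \<subseteq> {l. length l = D \<and> sum_list l = n}" by (auto simp: comp_def)
    have "(\<Sum>b\<in>B. l ! g b) = sum_list l" if "length l = D" for l :: "nat list"
    proof -
      have "(\<Sum>b\<in>B. l ! g b) = (\<Sum>i<D. l ! g (h i))"
        using sum.reindex_bij_betw[OF h, of "\<lambda>b. l ! g b"] by simp
      also have "\<dots> = (\<Sum>i<D. l ! i)" using gh by simp
      finally show ?thesis using that by (simp add: sum_list_sum_nth atLeast0LessThan)
    qed
    then show "(\<lambda>l. restrict (\<lambda>b. l ! g b) B) ` {l. length l = D \<and> sum_list l = n}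
        \<subseteq> {m \<in> B \<rightarrow>\<^sub>E (UNIV :: nat set). sum m B = n}" by auto
  qed
  then have *: "card {m \<in> B \<rightarrow>\<^sub>E (UNIV :: nat set). sum m B = n} = (n + D - 1) choose n"
    by (simp only: bij_betw_same_card card_length_sum_list)
  have "D > 0" using assms by (simp add: D_def card_gt_0_iff)
  then have "n \<le> n + D - 1" by simp
  from binomial_symmetric[OF this] * show ?thesis by (simp add: D_def)
qed

section \<open>Conical hulls and the bases among the generators\<close>

definition conical_hull :: "'a::real_vector set \<Rightarrow> 'a set" where
  "conical_hull V = {\<Sum>v\<in>V. u v *\<^sub>R v | u. \<forall>v\<in>V. 0 \<le> u v}"

text \<open>
  The cone over a lattice polytope, with its generators \<open>V\<close> placed at height 1.
\<close>

locale graded_cone =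
  fixes V L :: "'a::euclidean_space set" and ht :: "'a \<Rightarrow> real"
  assumes finite_V: "finite V" and span_V: "span V = UNIV"
    and linear_ht: "linear ht" and ht_V: "v \<in> V \<Longrightarrow> ht v = 1"
    and V_L: "V \<subseteq> L" and L_0: "0 \<in> L"
    and L_add: "x \<in> L \<Longrightarrow> y \<in> L \<Longrightarrow> x + y \<in> L"
    and L_diff: "x \<in> L \<Longrightarrow> y \<in> L \<Longrightarrow> x - y \<in> L"
    and ht_L: "x \<in> L \<Longrightarrow> ht x \<in> \<int>"
    and finite_slice: "finite {x \<in> L \<inter> conical_hull V. ht x = real n}"
begin

definition bases :: "'a set set" where
  "bases = {B. B \<subseteq> V \<and> independent B \<and> span B = UNIV}"

lemma basisD:
  assumes "B \<in> bases"
  shows "B \<subseteq> V" "independent B" "span B = UNIV" "finite B" "B \<noteq> {}" "card B = DIM('a)"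
proof -
  show *: "B \<subseteq> V" "independent B" "span B = UNIV" using assms by (auto simp: bases_def)
  show "finite B" using * finite_V finite_subset by blast
  show "card B = DIM('a)" using * dim_span_eq_card_independent[of B] by simp
  then show "B \<noteq> {}" by auto
qed

lemma finite_bases: "finite bases"
  by (rule finite_subset[of _ "Pow V"]) (use finite_V in \<open>auto simp: bases_def\<close>)

lemma linear_representation:
  assumes "B \<in> bases" shows "linear (\<lambda>x. representation B x i)"
  using basisD[OF assms]
  by (intro linearI) (simp_all add: representation_add representation_scale)

lemma sum_representation:
  assumes "B \<in> bases" shows "(\<Sum>i\<in>B. representation B x i *\<^sub>R i) = x"
  using basisD[OF assms] by (intro sum_representation_eq) auto

lemma representation_combination:
  assumes "B \<in> bases" "i \<in> B"
  shows "representation B (\<Sum>j\<in>B. a j *\<^sub>R j) i = a i"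
proof -
  note lin = linear_representation[OF \<open>B \<in> bases\<close>]
  have "representation B (\<Sum>j\<in>B. a j *\<^sub>R j) i = (\<Sum>j\<in>B. a j * representation B j i)"
    by (simp add: linear_sum[OF lin] linear_scale[OF lin])
  also have "\<dots> = (\<Sum>j\<in>B. if j = i then a j else 0)"
    using basisD[OF assms(1)] by (intro sum.cong) (auto simp: representation_basis)
  finally show ?thesis using assms basisD by simp
qed

lemma ht_combination: "S \<subseteq> V \<Longrightarrow> ht (\<Sum>v\<in>S. u v *\<^sub>R v) = sum u S"
  using ht_V by (auto simp: linear_sum[OF linear_ht] linear_scale[OF linear_ht] intro!: sum.cong)

lemma ht_eq_sum_representation: "B \<in> bases \<Longrightarrow> ht x = (\<Sum>i\<in>B. representation B x i)"
  using ht_combination[of B "representation B x"] sum_representation[of B x] basisD(1) by simp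

lemma conical_hull_memI:
  assumes "S \<subseteq> V" "\<And>v. v \<in> S \<Longrightarrow> 0 \<le> u v"
  shows "(\<Sum>v\<in>S. u v *\<^sub>R v) \<in> conical_hull V"
proof -
  have "(\<Sum>v\<in>S. u v *\<^sub>R v) = (\<Sum>v\<in>V. (if v \<in> S then u v else 0) *\<^sub>R v)"
    using assms finite_V by (intro sum.mono_neutral_cong_left) auto
  then show ?thesis unfolding conical_hull_def using assms by force
qed

lemma conical_hull_if_representation_nonneg:
  "B \<in> bases \<Longrightarrow> (\<And>i. i \<in> B \<Longrightarrow> 0 \<le> representation B x i) \<Longrightarrow> x \<in> conical_hull V"
  using conical_hull_memI[of B "representation B x"] sum_representation[of B x] basisD(1) by simp

lemma conical_hull_add:
  assumes "x \<in> conical_hull V" "y \<in> conical_hull V" "0 \<le> e"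
  shows "x + e *\<^sub>R y \<in> conical_hull V"
proof -
  obtain u w where "x = (\<Sum>v\<in>V. u v *\<^sub>R v)" "\<forall>v\<in>V. 0 \<le> u v"
    and "y = (\<Sum>v\<in>V. w v *\<^sub>R v)" "\<forall>v\<in>V. 0 \<le> w v"
    using assms by (auto simp: conical_hull_def)
  then have "x + e *\<^sub>R y = (\<Sum>v\<in>V. (u v + e * w v) *\<^sub>R v)" "\<forall>v\<in>V. 0 \<le> u v + e * w v"
    using \<open>0 \<le> e\<close> by (simp_all add: scaleR_sum_right sum.distrib scaleR_add_left)
  then show ?thesis by (auto simp: conical_hull_def)
qed

section \<open>Linear programming and the regular triangulation\<close>

text \<open>
  The ratio test of linear programming: move along a linear dependency in the direction that does
  not increase the cost until a coefficient vanishes.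
\<close>

lemma reduce_to_independent:
  assumes "S \<subseteq> V" "\<And>v. v \<in> S \<Longrightarrow> 0 \<le> u v"
  shows "\<exists>T w. T \<subseteq> S \<and> independent T \<and> (\<forall>v\<in>T. 0 \<le> w v) \<and>
           (\<Sum>v\<in>T. w v *\<^sub>R v) = (\<Sum>v\<in>S. u v *\<^sub>R v) \<and> (\<Sum>v\<in>T. w v * c v) \<le> (\<Sum>v\<in>S. u v * c v)"
  using assms
proof (induction "card S" arbitrary: S u rule: less_induct)
  case less
  have finS: "finite S" using less.prems finite_V finite_subset by blast
  show ?case
  proof (cases "independent S")
    case True
    then show ?thesis using less.prems by (intro exI[of _ S] exI[of _ u]) auto
  next
    case False
    then obtain a0 where a0: "\<exists>v\<in>S. a0 v \<noteq> 0" "(\<Sum>v\<in>S. a0 v *\<^sub>R v) = 0"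
      using dependent_finite[OF finS] by blast
    \<comment> \<open>The sign of the dependency is chosen so that moving along \<open>- a\<close>
      does not raise the cost.\<close>
    obtain a where a: "\<exists>v\<in>S. a v \<noteq> 0" "(\<Sum>v\<in>S. a v *\<^sub>R v) = 0" "0 \<le> (\<Sum>v\<in>S. a v * c v)"
    proof (cases "0 \<le> (\<Sum>v\<in>S. a0 v * c v)")
      case True
      then show ?thesis using a0 that by blast
    next
      case False
      then show ?thesis using a0 that[of "\<lambda>v. - a0 v"] by (auto simp: sum_negf)
    qed
    \<comment> \<open>All generators have height 1, so the coefficients of a dependency add up to 0.
      As they do not all vanish, one is positive, and the ratio test has a candidate.\<close>
    have suma: "sum a S = 0"
      using ht_combination[OF less.prems(1), of a] a(2) linear_0[OF linear_ht] by simp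
    define P where "P = {v \<in> S. a v > 0}"
    have "finite P" using finS by (simp add: P_def)
    have "P \<noteq> {}"
    proof
      assume "P = {}"
      then have "\<And>v. v \<in> S \<Longrightarrow> 0 \<le> - a v" by (force simp: P_def)
      then have "\<forall>v\<in>S. - a v = 0"
        using sum_nonneg_eq_0_iff[OF finS, of "\<lambda>v. - a v"] suma by (auto simp: sum_negf)
      then show False using a(1) by auto
    qed
    \<comment> \<open>The largest step that keeps every \<open>u v - \<theta> * a v\<close>
      nonnegative. The generator where the minimum is attained gets coefficient 0 and is
      dropped.\<close>
    define \<theta> where "\<theta> = Min ((\<lambda>v. u v / a v) ` P)"
    obtain w where w: "w \<in> P" "\<theta> = u w / a w"
      using Min_in[of "(\<lambda>v. u v / a v) ` P"] \<open>finite P\<close> \<open>P \<noteq> {}\<close> unfolding \<theta>_def by blast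
    have \<theta>_le: "\<theta> \<le> u v / a v" if "v \<in> P" for v
      unfolding \<theta>_def using that \<open>finite P\<close> by (intro Min_le) auto
    have "0 \<le> \<theta>" using w less.prems(2) by (auto simp: P_def)
    define u' where "u' v = u v - \<theta> * a v" for v
    have "w \<in> S" using w by (simp add: P_def)
    have u'w: "u' w = 0" using w by (simp add: u'_def P_def)
    have u'_nonneg: "0 \<le> u' v" if "v \<in> S" for v
    proof (cases "a v > 0")
      case True
      then have "\<theta> \<le> u v / a v" using that \<theta>_le by (simp add: P_def)
      then show ?thesis using True by (simp add: u'_def field_simps)
    next
      case False
      then have "\<theta> * a v \<le> 0" using \<open>0 \<le> \<theta>\<close> by (simp add: mult_nonneg_nonpos)
      then show ?thesis using less.prems(2)[OF that] by (simp add: u'_def)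
    qed
    have "card (S - {w}) < card S"
      using \<open>w \<in> S\<close> finS by (metis card_Diff1_less)
    then obtain T w' where T: "T \<subseteq> S - {w}" "independent T" "\<forall>v\<in>T. 0 \<le> w' v"
        "(\<Sum>v\<in>T. w' v *\<^sub>R v) = (\<Sum>v\<in>S - {w}. u' v *\<^sub>R v)"
        "(\<Sum>v\<in>T. w' v * c v) \<le> (\<Sum>v\<in>S - {w}. u' v * c v)"
      using less.hyps[of "S - {w}" u'] less.prems(1) u'_nonneg by blast
    have "(\<Sum>v\<in>S - {w}. u' v *\<^sub>R v) = (\<Sum>v\<in>S. u' v *\<^sub>R v)"
      using \<open>w \<in> S\<close> u'w finS by (simp add: sum.remove[of S w])
    also have "\<dots> = (\<Sum>v\<in>S. u v *\<^sub>R v) - \<theta> *\<^sub>R (\<Sum>v\<in>S. a v *\<^sub>R v)"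
      by (simp add: u'_def scaleR_diff_left sum_subtractf scaleR_sum_right)
    finally have 1: "(\<Sum>v\<in>S - {w}. u' v *\<^sub>R v) = (\<Sum>v\<in>S. u v *\<^sub>R v)" using a(2) by simp
    have "(\<Sum>v\<in>S - {w}. u' v * c v) = (\<Sum>v\<in>S. u' v * c v)"
      using \<open>w \<in> S\<close> u'w finS by (simp add: sum.remove[of S w])
    also have "\<dots> = (\<Sum>v\<in>S. u v * c v) - \<theta> * (\<Sum>v\<in>S. a v * c v)"
      by (simp add: u'_def left_diff_distrib sum_subtractf sum_distrib_left mult.assoc)
    also have "\<dots> \<le> (\<Sum>v\<in>S. u v * c v)" using a(3) \<open>0 \<le> \<theta>\<close> by simp
    finally show ?thesis using T 1 by (intro exI[of _ T] exI[of _ w']) auto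
  qed
qed

text \<open>
  For a generic cost \<open>c\<close>, the strictly dual feasible bases span the maximal cones of a regular
  triangulation.
\<close>

definition dual_feasible :: "('a \<Rightarrow> real) \<Rightarrow> 'a set set" where
  "dual_feasible c = {B \<in> bases. \<forall>v\<in>V - B. (\<Sum>i\<in>B. representation B v i * c i) < c v}"

text \<open>Weak duality with strict inequalities: the cost of y over a dual feasible basis is at
  most its cost over any other basis with positive coordinates, and strictly less unless the latter
  basis is contained in the former. Applied in both directions, this forces mutual
  inclusion.\<close>

lemma dual_feasible_unique:
  assumes B: "B \<in> dual_feasible c" and B': "B' \<in> dual_feasible c"
    and pos: "\<And>i. i \<in> B \<Longrightarrow> 0 < representation B y i"
    and pos': "\<And>i. i \<in> B' \<Longrightarrow> 0 < representation B' y i"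
  shows "B = B'"
proof -
  define cost where "cost B = (\<Sum>i\<in>B. representation B y i * c i)" for B
  have sub: "C' \<subseteq> C \<and> cost C \<le> cost C' \<or> cost C < cost C'"
    if C: "C \<in> dual_feasible c" and C': "C' \<in> dual_feasible c"
      and p: "\<And>i. i \<in> C' \<Longrightarrow> 0 < representation C' y i" for C C'
  proof -
    have b: "C \<in> bases" "C' \<in> bases" using C C' by (auto simp: dual_feasible_def)
    note lin = linear_representation[OF b(1)]
    \<comment> \<open>The linear functional that agrees with \<open>c\<close> on \<open>C\<close>.
      By strict dual feasibility it lies below \<open>c\<close> on the remaining generators.\<close>
    define r where "r v = (\<Sum>i\<in>C. representation C v i * c i)" for v
    have "cost C = (\<Sum>i\<in>C. representation C (\<Sum>j\<in>C'. representation C' y j *\<^sub>R j) i * c i)"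
      by (simp add: cost_def sum_representation[OF b(2)])
    also have "\<dots> = (\<Sum>i\<in>C. \<Sum>j\<in>C'. representation C' y j * representation C j i * c i)"
      by (simp add: linear_sum[OF lin] linear_scale[OF lin] sum_distrib_right)
    also have "\<dots> = (\<Sum>j\<in>C'. representation C' y j * r j)"
      by (subst sum.swap) (simp add: r_def sum_distrib_left mult.assoc)
    finally have cost: "cost C = (\<Sum>j\<in>C'. representation C' y j * r j)" .
    have r_eq: "r j = c j" if "j \<in> C" for j
    proof -
      have "r j = (\<Sum>i\<in>C. if i = j then c i else 0)"
        unfolding r_def using basisD[OF b(1)] that
        by (intro sum.cong) (auto simp: representation_basis)
      then show ?thesis using basisD[OF b(1)] that by simp
    qed
    have r_less: "r j < c j" if "j \<in> C' - C" for j
      using C that basisD[OF b(2)] by (auto simp: dual_feasible_def r_def)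
    have le: "representation C' y j * r j \<le> representation C' y j * c j" if "j \<in> C'" for j
      using p[OF that] r_eq r_less that by (cases "j \<in> C") (auto intro!: less_imp_le)
    show ?thesis
    proof (cases "C' \<subseteq> C")
      case True
      then show ?thesis unfolding cost unfolding cost_def using le by (auto intro!: sum_mono)
    next
      case False
      then obtain j where "j \<in> C' - C" by auto
      then have "representation C' y j * r j < representation C' y j * c j" "j \<in> C'"
        using p r_less by auto
      then have "cost C < cost C'"
        unfolding cost unfolding cost_def using le basisD[OF b(2)]
        by (intro sum_strict_mono_ex1) auto
      then show ?thesis ..
    qed
  qed
  show ?thesis using sub[OF B B' pos'] sub[OF B' B pos] by force
qed

text \<open>Among the bases whose cone contains y, one of least cost is dual feasible: otherwise a
  generator violating the inequality could be brought into the combination at a lower cost.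
  Genericity of \<open>c\<close> excludes equality of costs, and genericity of y makes the
  coordinates strictly positive.\<close>

lemma dual_feasible_exists:
  fixes c :: "'a \<Rightarrow> real"
  assumes c: "\<And>B v. B \<in> bases \<Longrightarrow> v \<in> V - B \<Longrightarrow> (\<Sum>i\<in>B. representation B v i * c i) \<noteq> c v"
    and y: "y \<in> conical_hull V"
    and generic: "\<And>B i. B \<in> bases \<Longrightarrow> i \<in> B \<Longrightarrow> representation B y i \<noteq> 0"
  shows "\<exists>B\<in>dual_feasible c. \<forall>i\<in>B. 0 < representation B y i"
proof -
  define cost where "cost B = (\<Sum>i\<in>B. representation B y i * c i)" for B
  define K where "K = {B \<in> bases. \<forall>i\<in>B. 0 \<le> representation B y i}"
  \<comment> \<open>A cheaper independent combination is completed to a basis. The added generators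
    get coefficient 0, so the cost stays the same.\<close>
  have into_K: "\<exists>B\<in>K. cost B \<le> (\<Sum>v\<in>S. u v * c v)"
    if S: "S \<subseteq> V" and u: "\<And>v. v \<in> S \<Longrightarrow> 0 \<le> u v" and yS: "y = (\<Sum>v\<in>S. u v *\<^sub>R v)" for S u
  proof -
    obtain T w where T: "T \<subseteq> S" "independent T" "\<forall>v\<in>T. 0 \<le> w v"
        "(\<Sum>v\<in>T. w v *\<^sub>R v) = y" "(\<Sum>v\<in>T. w v * c v) \<le> (\<Sum>v\<in>S. u v * c v)"
      using reduce_to_independent[of S u c] S u yS by auto
    obtain B where B: "T \<subseteq> B" "B \<subseteq> V" "independent B" "V \<subseteq> span B"
      using maximal_independent_subset_extend[of T V] T S by blast
    then have "span B = UNIV" using span_minimal[OF B(4) subspace_span] span_V by auto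
    then have Bb: "B \<in> bases" using B by (simp add: bases_def)
    note finB = basisD(4)[OF Bb]
    have "y = (\<Sum>v\<in>B. (if v \<in> T then w v else 0) *\<^sub>R v)"
      unfolding T(4)[symmetric] using B finB by (intro sum.mono_neutral_cong_left) auto
    then have rep: "representation B y v = (if v \<in> T then w v else 0)" if "v \<in> B" for v
      using representation_combination[OF Bb that, of "\<lambda>v. if v \<in> T then w v else 0"] by simp
    have "cost B = (\<Sum>v\<in>T. w v * c v)"
      unfolding cost_def using B finB rep by (intro sum.mono_neutral_cong_right) auto
    moreover have "B \<in> K" using Bb rep T(3) by (simp add: K_def)
    ultimately show ?thesis using T(5) by (intro bexI[of _ B]) simp_all
  qed
  obtain u where "\<forall>v\<in>V. 0 \<le> u v" "y = (\<Sum>v\<in>V. u v *\<^sub>R v)"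
    using y by (auto simp: conical_hull_def)
  then have "K \<noteq> {}" using into_K[of V u] by auto
  moreover have "finite K" using finite_bases by (simp add: K_def)
  ultimately obtain B where B: "B \<in> K" and min: "\<And>B'. B' \<in> K \<Longrightarrow> cost B \<le> cost B'"
    using ex_min_if_finite[of "cost ` K"] by (force simp: not_less)
  have Bb: "B \<in> bases" using B by (simp add: K_def)
  note Bd = basisD[OF Bb]
  have pos: "0 < representation B y i" if "i \<in> B" for i
    using B generic[OF Bb that] that by (force simp: K_def)
  have "(\<Sum>i\<in>B. representation B v i * c i) < c v" if v: "v \<in> V - B" for v
  proof (rule ccontr)
    assume "\<not> ?thesis"
    then have gt: "c v < (\<Sum>i\<in>B. representation B v i * c i)" using c[OF Bb v] by simp
    \<comment> \<open>A step short enough to keep all coordinates nonnegative, whatever the signs of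
      those of v; adding 1 avoids division by zero. It is positive because all coordinates of y
      are.\<close>
    define \<theta> where "\<theta> = Min ((\<lambda>i. representation B y i / (1 + \<bar>representation B v i\<bar>)) ` B)"
    have "0 < \<theta>"
      unfolding \<theta>_def using Bd pos by (subst Min_gr_iff) (auto intro!: divide_pos_pos)
    have nn: "0 \<le> representation B y i - \<theta> * representation B v i" if "i \<in> B" for i
    proof -
      have "\<theta> \<le> representation B y i / (1 + \<bar>representation B v i\<bar>)"
        unfolding \<theta>_def using Bd that by (intro Min_le) auto
      then have "\<theta> * (1 + \<bar>representation B v i\<bar>) \<le> representation B y i"
        by (simp add: pos_le_divide_eq)
      moreover have "\<theta> * representation B v i \<le> \<theta> * (1 + \<bar>representation B v i\<bar>)"
        using \<open>0 < \<theta>\<close> by (intro mult_left_mono) auto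
      ultimately show ?thesis by simp
    qed
    define u where "u i = (if i = v then \<theta> else representation B y i - \<theta> * representation B v i)" for i
    have u: "u v = \<theta>" "\<And>i. i \<in> B \<Longrightarrow> u i = representation B y i - \<theta> * representation B v i"
      using v by (auto simp: u_def)
    have "(\<Sum>i\<in>insert v B. u i *\<^sub>R i)
        = \<theta> *\<^sub>R v + ((\<Sum>i\<in>B. representation B y i *\<^sub>R i) - \<theta> *\<^sub>R (\<Sum>i\<in>B. representation B v i *\<^sub>R i))"
      using v Bd(4) by (simp add: u scaleR_diff_left sum_subtractf scaleR_sum_right)
    then have "y = (\<Sum>i\<in>insert v B. u i *\<^sub>R i)" by (simp add: sum_representation[OF Bb])
    then obtain B' where B': "B' \<in> K" "cost B' \<le> (\<Sum>i\<in>insert v B. u i * c i)"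
      using into_K[of "insert v B" u] v Bd(1) nn \<open>0 < \<theta>\<close> by (force simp: u_def)
    note B'(2)
    also have "(\<Sum>i\<in>insert v B. u i * c i)
        = cost B + \<theta> * (c v - (\<Sum>i\<in>B. representation B v i * c i))"
      using v Bd(4)
      by (simp add: u cost_def left_diff_distrib right_diff_distrib sum_subtractf sum_distrib_left mult.assoc)
    also have "\<dots> < cost B" using \<open>0 < \<theta>\<close> gt by (simp add: mult_pos_neg)
    finally show False using min[OF B'(1)] by simp
  qed
  then show ?thesis using Bb pos by (auto simp: dual_feasible_def)
qed

section \<open>Lattice points of half-open simplicial cones\<close>

text \<open>The lattice points of the half-open fundamental parallelepiped. On \<open>J\<close> the
  interval is closed at 1 instead of 0, so that translates by natural combinations of
  \<open>B\<close> tile the cone without its \<open>J\<close>-facets.\<close>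

definition box :: "'a set \<Rightarrow> 'a set \<Rightarrow> 'a set" where
  "box B J = {y \<in> L. (\<forall>i\<in>B - J. 0 \<le> representation B y i \<and> representation B y i < 1) \<and>
                     (\<forall>i\<in>J. 0 < representation B y i \<and> representation B y i \<le> 1)}"

definition half_open_cone :: "'a set \<Rightarrow> 'a set \<Rightarrow> 'a set" where
  "half_open_cone B J = {x. (\<forall>i\<in>B. 0 \<le> representation B x i) \<and> (\<forall>i\<in>J. 0 < representation B x i)}"

lemma L_multiples: "finite S \<Longrightarrow> S \<subseteq> V \<Longrightarrow> (\<Sum>i\<in>S. real (m i) *\<^sub>R i) \<in> L"
proof (induction S rule: finite_induct)
  case (insert i S)
  have "real k *\<^sub>R i \<in> L" for k
  proof (induction k)
    case (Suc k)
    then show ?case using L_add[of i "real k *\<^sub>R i"] insert V_L by (auto simp: algebra_simps)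
  qed (simp add: L_0)
  then show ?case using insert L_add by simp
qed (simp add: L_0)

lemma box_subset_half_open_cone:
  assumes "J \<subseteq> B" shows "box B J \<subseteq> half_open_cone B J"
  using assms by (fastforce simp: box_def half_open_cone_def)

lemma half_open_cone_subset: "B \<in> bases \<Longrightarrow> half_open_cone B J \<subseteq> conical_hull V"
  by (auto simp: half_open_cone_def intro: conical_hull_if_representation_nonneg)

text \<open>The height is the sum of coordinates, all between 0 and 1. Since \<open>J\<close> is a
  proper subset of \<open>B\<close>, one coordinate is strictly below 1, which keeps the height
  below \<open>DIM('a)\<close>; on \<open>L\<close> it is an integer.\<close>

lemma ht_box:
  assumes "B \<in> bases" "J \<subset> B" "y \<in> box B J"
  obtains j where "j < DIM('a)" "ht y = real j"
proof -
  note Bd = basisD[OF assms(1)]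
  have r: "0 \<le> representation B y i \<and> representation B y i \<le> 1" if "i \<in> B" for i
    using assms(3) that by (cases "i \<in> J") (auto simp: box_def intro: less_imp_le)
  obtain i where "i \<in> B" "representation B y i < 1"
    using assms by (auto simp: box_def)
  then have "(\<Sum>i\<in>B. representation B y i) < (\<Sum>i\<in>B. 1)"
    using r Bd by (intro sum_strict_mono_ex1) auto
  then have "ht y < DIM('a)" using Bd by (simp add: ht_eq_sum_representation[OF assms(1)])
  moreover have "0 \<le> ht y"
    using r by (auto simp: ht_eq_sum_representation[OF assms(1)] intro: sum_nonneg)
  moreover have "ht y \<in> \<int>" using assms(3) ht_L by (simp add: box_def)
  ultimately have "ht y = real (nat \<lfloor>ht y\<rfloor>)" "nat \<lfloor>ht y\<rfloor> < DIM('a)"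
    by (auto elim!: Ints_cases)
  then show ?thesis using that by blast
qed

lemma finite_box:
  assumes "B \<in> bases" "J \<subset> B" shows "finite (box B J)"
proof (rule finite_subset)
  show "finite (\<Union>j<DIM('a). {x \<in> L \<inter> conical_hull V. ht x = real j})"
    using finite_slice by blast
  show "box B J \<subseteq> (\<Union>j<DIM('a). {x \<in> L \<inter> conical_hull V. ht x = real j})"
  proof
    fix y assume y: "y \<in> box B J"
    obtain j where "j < DIM('a)" "ht y = real j" using ht_box[OF assms y] .
    moreover have "y \<in> L" using y by (simp add: box_def)
    moreover have "y \<in> conical_hull V"
      using y assms box_subset_half_open_cone[of J B] half_open_cone_subset[of B J] by auto
    ultimately show "y \<in> (\<Union>j<DIM('a). {x \<in> L \<inter> conical_hull V. ht x = real j})" by auto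
  qed
qed

text \<open>Subtracting integer parts of coordinates splits a lattice point uniquely into a box
  point and a natural combination of \<open>B\<close>. Over a box point of height
  \<open>j \<le> n\<close> the combinations are the weak compositions of \<open>n - j\<close> into
  \<open>DIM('a)\<close> parts.\<close>

lemma card_half_open_cone:
  assumes B: "B \<in> bases" and J: "J \<subset> B"
  shows "card {x \<in> L \<inter> half_open_cone B J. ht x = real n} =
    (\<Sum>j\<le>DIM('a) - 1. card {y \<in> box B J. ht y = real j} *
       ((n + (DIM('a) - 1) - j) choose (DIM('a) - 1)))"
proof -
  note Bd = basisD[OF B]
  define D where "D = DIM('a) - 1"
  have cardB: "card B - 1 = D" "card B = Suc D" using Bd(6) by (simp_all add: D_def)
  define comb where "comb m = (\<Sum>i\<in>B. real (m i) *\<^sub>R i)" for m :: "'a \<Rightarrow> nat"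
  \<comment> \<open>The integer part suited to the box: on \<open>J\<close> the value
    \<open>ceiling - 1\<close> leaves a remainder in (0, 1], elsewhere the floor leaves one in [0,
    1).\<close>
  define fl where "fl x i = nat (if i \<in> J then \<lceil>representation B x i\<rceil> - 1 else \<lfloor>representation B x i\<rfloor>)"
    for x i
  \<comment> \<open>The equation is stated over the reals, since truncated subtraction would let a
    box point above height n contribute the zero combination.\<close>
  define M where "M y = {m \<in> B \<rightarrow>\<^sub>E (UNIV :: nat set). real (sum m B) = real n - ht y}" for y
  note lin = linear_representation[OF B]
  have rep_comb: "representation B (comb m) i = real (m i)" if "i \<in> B" for m i
    using representation_combination[OF B that] by (simp add: comb_def)
  have comb_L: "comb m \<in> L" for m unfolding comb_def using Bd by (intro L_multiples)
  have ht_comb: "ht (comb m) = real (sum m B)" for m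
    unfolding comb_def using Bd by (subst ht_combination) auto
  have comb_restrict: "comb (restrict m B) = comb m" for m by (simp add: comb_def)
  have fl_eq: "fl (y + comb m) i = m i" if "y \<in> box B J" "i \<in> B" for y m i
  proof -
    have r: "representation B (y + comb m) i = representation B y i + real (m i)"
      using linear_add[OF lin] rep_comb[OF that(2)] by simp
    show ?thesis
    proof (cases "i \<in> J")
      case True
      then have "0 < representation B y i" "representation B y i \<le> 1" using that by (auto simp: box_def)
      then have "\<lceil>representation B (y + comb m) i\<rceil> = int (m i) + 1"
        unfolding r by (intro ceiling_unique) auto
      then show ?thesis using True by (simp add: fl_def)
    next
      case False
      then have "0 \<le> representation B y i" "representation B y i < 1" using that by (auto simp: box_def)
      then have "\<lfloor>representation B (y + comb m) i\<rfloor> = int (m i)"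
        unfolding r by (intro floor_unique) auto
      then show ?thesis using False by (simp add: fl_def)
    qed
  qed
  have "bij_betw (\<lambda>(y, m). y + comb m) (Sigma (box B J) M) {x \<in> L \<inter> half_open_cone B J. ht x = real n}"
  proof (rule bij_betw_byWitness[where f' = "\<lambda>x. (x - comb (fl x), restrict (fl x) B)"])
    show "\<forall>p\<in>Sigma (box B J) M. (\<lambda>x. (x - comb (fl x), restrict (fl x) B)) (case p of (y, m) \<Rightarrow> y + comb m) = p"
    proof (rule ballI)
      fix p assume "p \<in> Sigma (box B J) M"
      then obtain y m where p: "p = (y, m)" and y: "y \<in> box B J" and m: "m \<in> M y" by auto
      have *: "restrict (fl (y + comb m)) B = m"
        using fl_eq[OF y] m by (auto simp: M_def PiE_def extensional_def fun_eq_iff)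
      have "comb (fl (y + comb m)) = comb m" using comb_restrict[of "fl (y + comb m)"] * by simp
      then show "(\<lambda>x. (x - comb (fl x), restrict (fl x) B)) (case p of (y, m) \<Rightarrow> y + comb m) = p"
        using * by (simp add: p)
    qed
    show "\<forall>x\<in>{x \<in> L \<inter> half_open_cone B J. ht x = real n}.
        (case (x - comb (fl x), restrict (fl x) B) of (y, m) \<Rightarrow> y + comb m) = x"
      by (simp add: comb_restrict)
    show "(\<lambda>(y, m). y + comb m) ` Sigma (box B J) M \<subseteq> {x \<in> L \<inter> half_open_cone B J. ht x = real n}"
    proof (rule image_subsetI)
      fix p assume "p \<in> Sigma (box B J) M"
      then obtain y m where p: "p = (y, m)" and y: "y \<in> box B J" and m: "m \<in> M y" by auto
      have h: "y \<in> half_open_cone B J" using y J box_subset_half_open_cone[of J B] by auto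
      have "y + comb m \<in> half_open_cone B J"
      proof -
        have "representation B (y + comb m) i = representation B y i + real (m i)" if "i \<in> B" for i
          using rep_comb[OF that] linear_add[OF lin] by simp
        then show ?thesis
          using h J by (force simp: half_open_cone_def intro: add_pos_nonneg)
      qed
      moreover have "y + comb m \<in> L" using y comb_L L_add by (simp add: box_def)
      moreover have "ht (y + comb m) = real n"
        using m by (simp add: linear_add[OF linear_ht] ht_comb M_def)
      ultimately show "(case p of (y, m) \<Rightarrow> y + comb m) \<in> {x \<in> L \<inter> half_open_cone B J. ht x = real n}"
        by (simp add: p)
    qed
    show "(\<lambda>x. (x - comb (fl x), restrict (fl x) B)) ` {x \<in> L \<inter> half_open_cone B J. ht x = real n}
        \<subseteq> Sigma (box B J) M"
    proof (rule image_subsetI)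
      fix x assume "x \<in> {x \<in> L \<inter> half_open_cone B J. ht x = real n}"
      then have x: "x \<in> L" "x \<in> half_open_cone B J" "ht x = real n" by auto
      have "x - comb (fl x) \<in> box B J"
      proof -
        have r: "representation B (x - comb (fl x)) i = representation B x i - real (fl x i)" if "i \<in> B" for i
          using linear_diff[OF lin] rep_comb[OF that] by simp
        have "0 < representation B (x - comb (fl x)) i \<and> representation B (x - comb (fl x)) i \<le> 1"
          if i: "i \<in> J" for i
        proof -
          have "i \<in> B" using i J by auto
          have "0 < representation B x i" using x i by (simp add: half_open_cone_def)
          then have "0 < \<lceil>representation B x i\<rceil>" by simp
          then have "real (fl x i) = of_int (\<lceil>representation B x i\<rceil> - 1)"
            using i by (simp add: fl_def)
          then show ?thesis unfolding r[OF \<open>i \<in> B\<close>] by linarith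
        qed
        moreover have "0 \<le> representation B (x - comb (fl x)) i \<and> representation B (x - comb (fl x)) i < 1"
          if i: "i \<in> B - J" for i
        proof -
          have "i \<in> B" using i by auto
          have "0 \<le> representation B x i" using x i by (simp add: half_open_cone_def)
          then have "real (fl x i) = of_int \<lfloor>representation B x i\<rfloor>"
            using i by (simp add: fl_def)
          then show ?thesis unfolding r[OF \<open>i \<in> B\<close>] by linarith
        qed
        ultimately show ?thesis using x L_diff comb_L by (simp add: box_def)
      qed
      moreover have "restrict (fl x) B \<in> M (x - comb (fl x))"
        using x by (simp add: M_def linear_diff[OF linear_ht] ht_comb)
      ultimately show "(x - comb (fl x), restrict (fl x) B) \<in> Sigma (box B J) M" by simp
    qed
  qed
  then have "card {x \<in> L \<inter> half_open_cone B J. ht x = real n} = card (Sigma (box B J) M)"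
    by (simp add: bij_betw_same_card)
  have cardM: "finite (M y) \<and> card (M y) = (n + D - j) choose D" if "ht y = real j" "j \<le> D" for y j
  proof (cases "j \<le> n")
    case True
    then have "real (sum m B) = real n - real j \<longleftrightarrow> sum m B = n - j" for m :: "'a \<Rightarrow> nat"
      by (metis of_nat_diff of_nat_eq_iff)
    then have "M y = {m \<in> B \<rightarrow>\<^sub>E (UNIV :: nat set). sum m B = n - j}"
      unfolding M_def that(1) by blast
    then have "card (M y) = (n + D - j) choose D"
      using card_weak_compositions[OF Bd(4,5), of "n - j"] cardB True by simp
    \<comment> \<open>Infinite sets have cardinality 0, so a positive count also yields
      finiteness.\<close>
    moreover from this have "card (M y) > 0" using that True by (simp add: zero_less_binomial_iff)
    ultimately show ?thesis using card_gt_0_iff by blast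
  next
    case False
    then have "m \<notin> M y" for m using that by (auto simp: M_def simp flip: of_nat_sum)
    then have "M y = {}" by auto
    \<comment> \<open>Here \<open>n + D - j < D\<close>, without truncation because
      \<open>j \<le> D\<close>, so the binomial coefficient vanishes too.\<close>
    then show ?thesis using False that by (simp add: binomial_eq_0)
  qed
  have ht_le: "\<exists>j\<le>D. ht y = real j" if y: "y \<in> box B J" for y
  proof -
    obtain j where "j < DIM('a)" "ht y = real j" using ht_box[OF B J y] .
    then show ?thesis by (intro exI[of _ j]) (auto simp: D_def)
  qed
  have finM: "\<forall>y\<in>box B J. finite (M y)" using ht_le cardM by blast
  note \<open>card {x \<in> L \<inter> half_open_cone B J. ht x = real n} = card (Sigma (box B J) M)\<close>
  also have "card (Sigma (box B J) M) = (\<Sum>y\<in>box B J. card (M y))"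
    using finite_box[OF B J] finM by (rule card_SigmaI)
  also have "\<dots> = (\<Sum>j\<in>real ` {..D}. \<Sum>y\<in>{y \<in> box B J. ht y = j}. card (M y))"
    using finite_box[OF B J] ht_le by (intro sum.group[symmetric]) auto
  also have "\<dots> = (\<Sum>j\<le>D. \<Sum>y\<in>{y \<in> box B J. ht y = real j}. card (M y))"
    by (subst sum.reindex) (auto simp: inj_on_def)
  also have "\<dots> = (\<Sum>j\<le>D. card {y \<in> box B J. ht y = real j} * ((n + D - j) choose D))"
    using cardM by (intro sum.cong) auto
  finally show ?thesis by (simp add: D_def)
qed

section \<open>Half-open decomposition of the cone and counting in slices\<close>

text \<open>
  Half-open decomposition: a generic point \<open>q\<close> of the cone decides on which facets a maximal cone
  is open, a point \<open>x\<close> being assigned to the maximal cone that contains \<open>x + e q\<close> for small \<open>e > 0\<close>.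
\<close>

lemma half_open_decomposition:
  assumes c: "\<And>B v. B \<in> bases \<Longrightarrow> v \<in> V - B \<Longrightarrow> (\<Sum>i\<in>B. representation B v i * c i) \<noteq> c v"
    and q: "q \<in> conical_hull V"
    and generic: "\<And>B i. B \<in> bases \<Longrightarrow> i \<in> B \<Longrightarrow> representation B q i \<noteq> 0"
    and x: "x \<in> conical_hull V"
  shows "\<exists>!B. B \<in> dual_feasible c \<and> x \<in> half_open_cone B {i \<in> B. representation B q i < 0}"
proof -
  \<comment> \<open>An \<open>e\<close> below all these ratios is too small for
    \<open>e *\<^sub>R q\<close> to change the sign of a nonzero coordinate of x in any
    basis.\<close>
  define I where "I = (\<lambda>(B, i). \<bar>representation B x i\<bar> / (1 + \<bar>representation B q i\<bar>)) `
    {(B, i) \<in> Sigma bases (\<lambda>B. B). representation B x i \<noteq> 0}"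
  have "finite (Sigma bases (\<lambda>B. B))" using finite_bases basisD(4) by (intro finite_SigmaI) auto
  then have "finite I" unfolding I_def
    by (intro finite_imageI, elim finite_subset[rotated]) auto
  moreover have "\<forall>z\<in>I. 0 < z" by (auto simp: I_def intro!: divide_pos_pos)
  \<comment> \<open>The element 1 is inserted so that the minimum exists even if \<open>I\<close> is
    empty.\<close>
  ultimately obtain e where e: "0 < e" "\<forall>z\<in>I. e \<le> z"
    using Min_gr_iff[of "insert 1 I" 0] Min_le[of "insert 1 I"] by (metis finite_insert insert_iff insert_not_empty zero_less_one)
  define y where "y = x + e *\<^sub>R q"
  have small: "e * \<bar>representation B q i\<bar> < \<bar>representation B x i\<bar>"
    if "B \<in> bases" "i \<in> B" "representation B x i \<noteq> 0" for B i
  proof -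
    have "e \<le> \<bar>representation B x i\<bar> / (1 + \<bar>representation B q i\<bar>)"
      using e(2) that by (force simp: I_def)
    then have "e * (1 + \<bar>representation B q i\<bar>) \<le> \<bar>representation B x i\<bar>"
      by (simp add: pos_le_divide_eq)
    then show ?thesis using e(1) by (simp add: distrib_left)
  qed
  have rep: "representation B y i = representation B x i + e * representation B q i" if "B \<in> bases" for B i
    unfolding y_def
    by (simp add: linear_add[OF linear_representation[OF that]] linear_scale[OF linear_representation[OF that]])
  have y0: "representation B y i \<noteq> 0" if Bi: "B \<in> bases" "i \<in> B" for B i
  proof (cases "representation B x i = 0")
    case True
    then show ?thesis using rep[OF Bi(1), of i] generic[OF Bi] e(1) by simp
  next
    case False
    have "\<bar>e * representation B q i\<bar> < \<bar>representation B x i\<bar>"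
      using small[OF Bi False] e(1) by (simp add: abs_mult)
    then show ?thesis using rep[OF Bi(1), of i] by linarith
  qed
  \<comment> \<open>A nonzero coordinate of x keeps its sign at y, and a zero coordinate takes the
    sign of the one of \<open>q\<close>. So positivity at y is exactly the half-open condition at
    x.\<close>
  have pos: "0 < representation B y i \<longleftrightarrow>
      0 \<le> representation B x i \<and> (representation B q i < 0 \<longrightarrow> 0 < representation B x i)"
    if Bi: "B \<in> bases" "i \<in> B" for B i
  proof (cases "representation B x i = 0")
    case True
    then show ?thesis using rep[OF Bi(1), of i] generic[OF Bi] e(1) by (auto simp: zero_less_mult_iff)
  next
    case False
    have "\<bar>e * representation B q i\<bar> < \<bar>representation B x i\<bar>"
      using small[OF Bi False] e(1) by (simp add: abs_mult)
    then show ?thesis using rep[OF Bi(1), of i] False by auto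
  qed
  have mem: "x \<in> half_open_cone B {i \<in> B. representation B q i < 0} \<longleftrightarrow> (\<forall>i\<in>B. 0 < representation B y i)"
    if "B \<in> dual_feasible c" for B
    using pos that by (auto simp: half_open_cone_def dual_feasible_def)
  have "y \<in> conical_hull V" unfolding y_def using x q e(1) by (intro conical_hull_add) auto
  then obtain B where "B \<in> dual_feasible c" "\<forall>i\<in>B. 0 < representation B y i"
    using dual_feasible_exists[OF c _ y0] by blast
  then show ?thesis using mem dual_feasible_unique by blast
qed

text \<open>\<open>h j\<close> adds up the box points of height j over the half-open cones of the
  decomposition. The origin lies in one of these cones; all its coordinates vanish, so that cone has
  no removed facet and its box contains the origin, whence \<open>h 0\<close> is positive.\<close>

theorem slice_counting:
  obtains h :: "nat \<Rightarrow> nat" where "0 < h 0"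
    "\<And>n. card {x \<in> L \<inter> conical_hull V. ht x = real n} =
       (\<Sum>j\<le>DIM('a) - 1. h j * ((n + (DIM('a) - 1) - j) choose (DIM('a) - 1)))"
proof -
  \<comment> \<open>The coefficients of the linear form in \<open>c\<close> that must not vanish for
    \<open>c\<close> to be generic. The form is nonzero for v outside \<open>B\<close>, having
    coefficient 1 at v.\<close>
  define \<alpha> where "\<alpha> = (\<lambda>(B :: 'a set, v) w. (if w = v then 1 else 0) - (if w \<in> B then representation B v w else 0))"
  have rsum: "(\<Sum>w\<in>V. \<alpha> (B, v) w * c w) = c v - (\<Sum>i\<in>B. representation B v i * c i)"
    if "B \<in> bases" "v \<in> V" for B v c
  proof -
    have "(\<Sum>w\<in>V. \<alpha> (B, v) w * c w)
        = (\<Sum>w\<in>V. if w = v then c w else 0) - (\<Sum>w\<in>V. if w \<in> B then representation B v w * c w else 0)"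
      unfolding sum_subtractf[symmetric] by (intro sum.cong) (auto simp: \<alpha>_def algebra_simps)
    also have "(\<Sum>w\<in>V. if w \<in> B then representation B v w * c w else 0) = (\<Sum>i\<in>B. representation B v i * c i)"
      using basisD[OF that(1)] finite_V by (intro sum.mono_neutral_cong_right) auto
    finally show ?thesis using that finite_V by simp
  qed
  have F: "finite (\<alpha> ` Sigma bases (\<lambda>B. V - B))" using finite_bases finite_V by auto
  have nz: "\<forall>a\<in>\<alpha> ` Sigma bases (\<lambda>B. V - B). \<exists>w\<in>V. a w \<noteq> 0"
    by (force simp: \<alpha>_def)
  from generic_weights[OF finite_V F nz] obtain c where c0: "\<And>a. a \<in> \<alpha> ` Sigma bases (\<lambda>B. V - B) \<Longrightarrow> (\<Sum>v\<in>V. a v * c v) \<noteq> 0"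
    by blast
  have c: "(\<Sum>i\<in>B. representation B v i * c i) \<noteq> c v" if "B \<in> bases" "v \<in> V - B" for B v
  proof -
    have "\<alpha> (B, v) \<in> \<alpha> ` Sigma bases (\<lambda>B. V - B)" using that by blast
    then have "(\<Sum>w\<in>V. \<alpha> (B, v) w * c w) \<noteq> 0" using c0 by blast
    then show ?thesis using rsum[of B v c] that by simp
  qed
  \<comment> \<open>The coordinate i of a combination of \<open>V\<close> as a linear form in its
    weights. Its coefficient at the generator i itself is 1.\<close>
  define \<beta> where "\<beta> = (\<lambda>(B :: 'a set, i) v. representation B v i :: real)"
  have F': "finite (\<beta> ` Sigma bases (\<lambda>B. B))" using finite_bases basisD(4) by auto
  have nz': "\<forall>a\<in>\<beta> ` Sigma bases (\<lambda>B. B). \<exists>w\<in>V. a w \<noteq> 0"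
    using basisD by (force simp: \<beta>_def representation_basis)
  from generic_weights[OF finite_V F' nz'] obtain d where d: "\<And>v. 0 < d v"
      and d0: "\<And>a. a \<in> \<beta> ` Sigma bases (\<lambda>B. B) \<Longrightarrow> (\<Sum>v\<in>V. a v * d v) \<noteq> 0"
    by blast
  define q where "q = (\<Sum>v\<in>V. d v *\<^sub>R v)"
  have q: "q \<in> conical_hull V" unfolding q_def using d by (intro conical_hull_memI) (auto intro: less_imp_le)
  have generic: "representation B q i \<noteq> 0" if "B \<in> bases" "i \<in> B" for B i
  proof -
    note lin = linear_representation[OF that(1)]
    have "representation B q i = (\<Sum>v\<in>V. \<beta> (B, i) v * d v)"
      by (simp add: q_def \<beta>_def linear_sum[OF lin] linear_scale[OF lin] mult.commute)
    then show ?thesis using d0[of "\<beta> (B, i)"] that by auto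
  qed
  define J where "J B = {i \<in> B. representation B q i < 0}" for B
  have "V \<noteq> {}"
  proof
    assume "V = {}"
    then have "DIM('a) = 0" using span_V dim_UNIV[where 'a = 'a] by (metis dim_empty dim_span)
    then show False by simp
  qed
  \<comment> \<open>The height of \<open>q\<close> is positive and equals the sum of its
    coordinates, so not all of them are negative.\<close>
  have J: "J B \<subset> B" if "B \<in> bases" for B
  proof -
    have "ht q > 0"
      unfolding q_def using d \<open>V \<noteq> {}\<close> finite_V by (subst ht_combination) (auto intro: sum_pos)
    then have "\<exists>i\<in>B. representation B q i > 0"
      unfolding ht_eq_sum_representation[OF that] by (meson not_less sum_nonpos)
    then show ?thesis by (force simp: J_def)
  qed
  define h where "h j = (\<Sum>B\<in>dual_feasible c. card {y \<in> box B (J B). ht y = real j})" for j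
  have sub: "dual_feasible c \<subseteq> bases" by (auto simp: dual_feasible_def)
  then have fin: "finite (dual_feasible c)" using finite_bases finite_subset by blast
  note decomp = half_open_decomposition[OF c q generic, folded J_def]
  show ?thesis
  proof (rule that)
    have "0 \<in> conical_hull V" using conical_hull_memI[of "{}"] by simp
    then obtain B where B: "B \<in> dual_feasible c" "0 \<in> half_open_cone B (J B)"
      using decomp[of 0] by blast
    then have "J B = {}" by (auto simp: half_open_cone_def representation_zero)
    then have "0 \<in> {y \<in> box B (J B). ht y = real 0}"
      using L_0 by (simp add: box_def representation_zero linear_0[OF linear_ht])
    moreover have "B \<in> bases" using sub B by auto
    ultimately have "0 < card {y \<in> box B (J B). ht y = real 0}"
      using finite_box[of B "J B"] J[of B] by (subst card_gt_0_iff) auto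
    then show "0 < h 0" unfolding h_def using B fin by (subst sum_pos2[of _ B]) auto
  next
    fix n
    have "{x \<in> L \<inter> conical_hull V. ht x = real n}
        = (\<Union>B\<in>dual_feasible c. {x \<in> L \<inter> half_open_cone B (J B). ht x = real n})"
      using decomp half_open_cone_subset sub by fast
    then have "card {x \<in> L \<inter> conical_hull V. ht x = real n}
        = card (\<Union>B\<in>dual_feasible c. {x \<in> L \<inter> half_open_cone B (J B). ht x = real n})" by simp
    also have "\<dots> = (\<Sum>B\<in>dual_feasible c. card {x \<in> L \<inter> half_open_cone B (J B). ht x = real n})"
    proof (rule card_UN_disjoint[OF fin])
      show "\<forall>B\<in>dual_feasible c. finite {x \<in> L \<inter> half_open_cone B (J B). ht x = real n}"
      proof
        fix B assume "B \<in> dual_feasible c"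
        then show "finite {x \<in> L \<inter> half_open_cone B (J B). ht x = real n}"
          using half_open_cone_subset sub by (intro finite_subset[OF _ finite_slice[of n]]) auto
      qed
      show "\<forall>B\<in>dual_feasible c. \<forall>B'\<in>dual_feasible c. B \<noteq> B' \<longrightarrow>
          {x \<in> L \<inter> half_open_cone B (J B). ht x = real n} \<inter>
          {x \<in> L \<inter> half_open_cone B' (J B'). ht x = real n} = {}"
        using decomp half_open_cone_subset sub by fast
    qed
    also have "\<dots> = (\<Sum>B\<in>dual_feasible c. \<Sum>j\<le>DIM('a) - 1. card {y \<in> box B (J B). ht y = real j} *
        ((n + (DIM('a) - 1) - j) choose (DIM('a) - 1)))"
      using card_half_open_cone J sub by (intro sum.cong) auto
    also have "\<dots> = (\<Sum>j\<le>DIM('a) - 1. h j * ((n + (DIM('a) - 1) - j) choose (DIM('a) - 1)))"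
      by (subst sum.swap) (simp add: h_def sum_distrib_right)
    finally show "card {x \<in> L \<inter> conical_hull V. ht x = real n}
        = (\<Sum>j\<le>DIM('a) - 1. h j * ((n + (DIM('a) - 1) - j) choose (DIM('a) - 1)))" .
  qed
qed

end

section \<open>From the polytope to the cone over it\<close>

lemma finite_bounded_lattice_points:
  fixes S :: "(real ^ 'd) set"
  assumes "bounded S" shows "finite (S \<inter> lattice_points)"
proof -
  obtain b where b: "\<And>x. x \<in> S \<Longrightarrow> norm x \<le> b" using assms by (auto simp: bounded_iff)
  define Z where "Z = real_of_int ` {- \<lceil>b\<rceil>..\<lceil>b\<rceil>}"
  have "S \<inter> lattice_points \<subseteq> vec_lambda ` (UNIV \<rightarrow>\<^sub>E Z)"
  proof
    fix x assume x: "x \<in> S \<inter> lattice_points"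
    have "x $ i \<in> Z" for i
    proof -
      obtain z where z: "x $ i = of_int z" using x by (auto simp: lattice_points_def elim: Ints_cases)
      have "\<bar>x $ i\<bar> \<le> b" using component_le_norm_cart[of x i] b[of x] x by auto
      then have "z \<in> {- \<lceil>b\<rceil>..\<lceil>b\<rceil>}" unfolding z by (auto simp: abs_le_iff; linarith)
      then show ?thesis unfolding Z_def z by blast
    qed
    then have "vec_nth x \<in> UNIV \<rightarrow>\<^sub>E Z" by auto
    then show "x \<in> vec_lambda ` (UNIV \<rightarrow>\<^sub>E Z)" by (metis image_eqI vec_nth_inverse)
  qed
  moreover have "finite (UNIV \<rightarrow>\<^sub>E Z :: ('d \<Rightarrow> real) set)" by (intro finite_PiE) (auto simp: Z_def)
  ultimately show ?thesis by (meson finite_imageI finite_subset)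
qed

lemma conical_hull_homogenization:
  fixes V :: "'a::real_vector set"
  shows "conical_hull ((\<lambda>v. (v, 1::real)) ` V) = {(\<Sum>v\<in>V. u v *\<^sub>R v, sum u V) | u. \<forall>v\<in>V. 0 \<le> u v}"
proof -
  have inj: "inj_on (\<lambda>v. (v, 1::real)) V" by (auto simp: inj_on_def)
  have pair: "(\<Sum>v\<in>V. u v *\<^sub>R (v, 1::real)) = (\<Sum>v\<in>V. u v *\<^sub>R v, sum u V)" for u :: "'a \<Rightarrow> real"
    by (simp add: prod_eq_iff fst_sum snd_sum)
  show ?thesis
  proof (intro set_eqI iffI)
    fix z assume "z \<in> conical_hull ((\<lambda>v. (v, 1::real)) ` V)"
    then obtain u where u: "z = (\<Sum>w\<in>(\<lambda>v. (v, 1::real)) ` V. u w *\<^sub>R w)" "\<forall>w\<in>(\<lambda>v. (v, 1::real)) ` V. 0 \<le> u w"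
      unfolding conical_hull_def by blast
    then have "z = (\<Sum>v\<in>V. u (v, 1) *\<^sub>R (v, 1))" "\<forall>v\<in>V. 0 \<le> u (v, 1)"
      by (simp_all add: sum.reindex[OF inj] comp_def del: scaleR_Pair)
    then show "z \<in> {(\<Sum>v\<in>V. u v *\<^sub>R v, sum u V) | u. \<forall>v\<in>V. 0 \<le> u v}"
      using pair[of "\<lambda>v. u (v, 1)"] by auto
  next
    fix z assume "z \<in> {(\<Sum>v\<in>V. u v *\<^sub>R v, sum u V) | u. \<forall>v\<in>V. 0 \<le> u v}"
    then obtain u where "z = (\<Sum>v\<in>V. u v *\<^sub>R (v, 1))" "\<forall>v\<in>V. 0 \<le> u v"
      using pair by auto
    then show "z \<in> conical_hull ((\<lambda>v. (v, 1::real)) ` V)"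
      unfolding conical_hull_def
      by (intro CollectI exI[of _ "u \<circ> fst"]) (auto simp: sum.reindex[OF inj])
  qed
qed

lemma scaled_convex_hull_eq_slice:
  fixes V :: "'a::real_vector set"
  assumes "finite V" "1 \<le> n"
  shows "x \<in> (\<lambda>x. real n *\<^sub>R x) ` (convex hull V) \<longleftrightarrow> (x, real n) \<in> conical_hull ((\<lambda>v. (v, 1)) ` V)"
proof
  assume "x \<in> (\<lambda>x. real n *\<^sub>R x) ` (convex hull V)"
  then obtain u where "\<forall>v\<in>V. 0 \<le> u v" "sum u V = 1" "x = real n *\<^sub>R (\<Sum>v\<in>V. u v *\<^sub>R v)"
    using assms by (auto simp: convex_hull_finite)
  then have "(x, real n) = (\<Sum>v\<in>V. (real n * u v) *\<^sub>R v, \<Sum>v\<in>V. real n * u v)" "\<forall>v\<in>V. 0 \<le> real n * u v"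
    by (simp_all add: scaleR_sum_right flip: sum_distrib_left)
  then show "(x, real n) \<in> conical_hull ((\<lambda>v. (v, 1)) ` V)"
    unfolding conical_hull_homogenization
    by (intro CollectI exI[of _ "\<lambda>v. real n * u v"] conjI)
next
  assume "(x, real n) \<in> conical_hull ((\<lambda>v. (v, 1)) ` V)"
  then obtain u where u: "\<forall>v\<in>V. 0 \<le> u v" "sum u V = real n" "x = (\<Sum>v\<in>V. u v *\<^sub>R v)"
    by (auto simp: conical_hull_homogenization)
  have "(\<Sum>v\<in>V. (u v / real n) *\<^sub>R v) \<in> convex hull V"
    using u assms by (auto simp: convex_hull_finite simp flip: sum_divide_distrib
        intro!: exI[of _ "\<lambda>v. u v / real n"])
  moreover have "x = real n *\<^sub>R (\<Sum>v\<in>V. (u v / real n) *\<^sub>R v)"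
    using u assms by (simp add: scaleR_sum_right)
  ultimately show "x \<in> (\<lambda>x. real n *\<^sub>R x) ` (convex hull V)" by blast
qed

text \<open>Affine combinations of \<open>V\<close> lift to every point of the form
  \<open>(x, 1)\<close>; these already span, as
  \<open>(x, t) = ((x, 1) - (0, 1)) + t *\<^sub>R (0, 1)\<close>.\<close>

lemma span_homogenization:
  fixes V :: "'a::real_vector set"
  assumes "affine hull V = UNIV" "finite V"
  shows "span ((\<lambda>v. (v, 1::real)) ` V) = UNIV"
proof -
  have 1: "(x, 1) \<in> span ((\<lambda>v. (v, 1::real)) ` V)" for x
  proof -
    have "x \<in> affine hull V" using assms by simp
    then obtain u where u: "sum u V = 1" "(\<Sum>v\<in>V. u v *\<^sub>R v) = x"
      using assms(2) by (auto simp: affine_hull_finite)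
    then have "(x, 1::real) = (\<Sum>v\<in>V. u v *\<^sub>R (v, 1))"
      by (simp add: prod_eq_iff fst_sum snd_sum)
    also have "\<dots> \<in> span ((\<lambda>v. (v, 1::real)) ` V)"
      by (intro span_sum span_scale span_base) auto
    finally show ?thesis .
  qed
  have "(x, t) \<in> span ((\<lambda>v. (v, 1::real)) ` V)" for x t
  proof -
    have "(x, t) = ((x, 1) - (0, 1)) + t *\<^sub>R (0, 1)" by simp
    then show ?thesis using 1 by (metis span_add span_diff span_scale)
  qed
  then show ?thesis by auto
qed

text \<open>For \<open>n \<ge> 1\<close> the slice of the cone at height n is a copy of the n-th
  dilate of \<open>P\<close>, so \<open>slice_counting\<close> applies to the lifted vertices. The
  cone lives in dimension \<open>CARD('d) + 1\<close>, and full dimension of \<open>P\<close> makes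
  its generators span.\<close>

theorem ehr_hstar_expansion:
  fixes P :: "(real ^ 'd) set"
  assumes "lattice_polytope P" "aff_dim P = int CARD('d)"
  obtains h :: "nat \<Rightarrow> nat" where "0 < h 0"
    "\<And>n. 1 \<le> n \<Longrightarrow> ehr P n = (\<Sum>j\<le>CARD('d). h j * ((n + CARD('d) - j) choose CARD('d)))"
proof -
  obtain V where V: "finite V" "V \<subseteq> lattice_points" "P = convex hull V"
    using assms by (auto simp: lattice_polytope_def)
  define W where "W = (\<lambda>v. (v, 1::real)) ` V"
  define L :: "((real ^ 'd) \<times> real) set" where "L = lattice_points \<times> \<int>"
  have "affine hull V = UNIV"
    using assms(2) by (simp add: V(3) aff_dim_convex_hull flip: aff_dim_eq_full)
  have fin: "finite {z \<in> L \<inter> conical_hull W. snd z = real n}" for n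
  proof (rule finite_subset)
    \<comment> \<open>At height n the nonnegative coefficients add up to n, so each is at most n;
      this bounds the norm of the point.\<close>
    define b where "b = (\<Sum>v\<in>V. real n * norm v)"
    show "finite ((\<lambda>x. (x, real n)) ` (cball 0 b \<inter> lattice_points :: (real ^ 'd) set))"
      by (intro finite_imageI finite_bounded_lattice_points bounded_cball)
    show "{z \<in> L \<inter> conical_hull W. snd z = real n} \<subseteq> (\<lambda>x. (x, real n)) ` (cball 0 b \<inter> lattice_points)"
    proof
      fix z assume z: "z \<in> {z \<in> L \<inter> conical_hull W. snd z = real n}"
      then obtain u where u: "z = (\<Sum>v\<in>V. u v *\<^sub>R v, sum u V)" "\<forall>v\<in>V. 0 \<le> u v"
        by (auto simp: W_def conical_hull_homogenization)
      have "u v \<le> real n" if "v \<in> V" for v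
        using z u member_le_sum[OF that, of u] V(1) by auto
      then have "norm (\<Sum>v\<in>V. u v *\<^sub>R v) \<le> b"
        unfolding b_def using u(2) by (intro sum_norm_le) (auto intro: mult_right_mono)
      then show "z \<in> (\<lambda>x. (x, real n)) ` (cball 0 b \<inter> lattice_points)"
        using z u(1) by (auto simp: L_def)
    qed
  qed
  interpret graded_cone W L snd
  proof (rule graded_cone.intro)
    show "finite W" using V by (simp add: W_def)
    show "span W = UNIV" unfolding W_def using \<open>affine hull V = UNIV\<close> V(1) by (rule span_homogenization)
    show "linear (snd :: (real ^ 'd) \<times> real \<Rightarrow> real)" by (rule linear_snd)
  qed (use V fin in \<open>auto simp: W_def L_def lattice_points_def mem_Times_iff\<close>)
  obtain h where h: "0 < h 0"
    "\<And>n. card {x \<in> L \<inter> conical_hull W. snd x = real n} =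
       (\<Sum>j\<le>CARD('d). h j * ((n + CARD('d) - j) choose CARD('d)))"
    using slice_counting by auto
  have "ehr P n = (\<Sum>j\<le>CARD('d). h j * ((n + CARD('d) - j) choose CARD('d)))" if "1 \<le> n" for n
  proof -
    have "{x \<in> L \<inter> conical_hull W. snd x = real n} = (\<lambda>x. (x, real n)) ` ((\<lambda>x. real n *\<^sub>R x) ` P \<inter> lattice_points)"
      using scaled_convex_hull_eq_slice[OF V(1) that] by (force simp: L_def W_def V(3))
    then have "card {x \<in> L \<inter> conical_hull W. snd x = real n} = ehr P n"
      by (simp add: ehr_def card_image inj_on_def)
    then show ?thesis using h(2)[of n] by simp
  qed
  then show ?thesis using that h(1) by blast
qed

section \<open>Uniqueness of the two binomial expansions and the values of \<open>hstar\<close> and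
  \<open>fstar\<close>\<close>

text \<open>Evaluation at \<open>n = k + 1\<close> kills all terms of index above k and gives
  \<open>f k\<close> the factor 1, so the system is triangular.\<close>

lemma binomial_basis_unique:
  fixes f :: "nat \<Rightarrow> real"
  assumes "\<And>n. 1 \<le> n \<Longrightarrow> (\<Sum>k\<le>d. f k * real ((n - 1) choose k)) = 0" "k \<le> d"
  shows "f k = 0"
  using assms(2)
proof (induction k rule: less_induct)
  case (less k)
  have "0 = (\<Sum>j\<le>d. f j * real (k choose j))" using assms(1)[of "Suc k"] by simp
  also have "\<dots> = (\<Sum>j\<in>{k}. f j * real (k choose j))"
    using less by (intro sum.mono_neutral_right) (auto simp: not_less_iff_gr_or_eq binomial_eq_0 neq_iff)
  finally show ?case by simp
qed

lemma hstar_to_fstar_sum: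
  fixes h :: "nat \<Rightarrow> real"
  assumes "1 \<le> n"
  shows "(\<Sum>j\<le>d. h j * real ((n + d - j) choose d)) =
    (\<Sum>k\<le>d. (\<Sum>j\<le>d. h j * real (Suc (d - j) choose (d - k))) * real ((n - 1) choose k))"
proof -
  have "real ((n + d - j) choose d) = (\<Sum>k\<le>d. real (Suc (d - j) choose (d - k)) * real ((n - 1) choose k))"
    if "j \<le> d" for j
  proof -
    \<comment> \<open>Vandermonde for the splitting
      \<open>n + d - j = (n - 1) + Suc (d - j)\<close>, which is exact because
      \<open>1 \<le> n\<close> and \<open>j \<le> d\<close>.\<close>
    have "(n + d - j) choose d = (\<Sum>k\<le>d. ((n - 1) choose k) * (Suc (d - j) choose (d - k)))"
      unfolding vandermonde using assms that by (intro arg_cong2[where f = binomial]) auto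
    then show ?thesis by (simp add: mult.commute)
  qed
  then have "(\<Sum>j\<le>d. h j * real ((n + d - j) choose d)) =
    (\<Sum>j\<le>d. \<Sum>k\<le>d. h j * real (Suc (d - j) choose (d - k)) * real ((n - 1) choose k))"
    by (simp add: sum_distrib_left mult.assoc)
  then show ?thesis by (subst (asm) sum.swap) (simp add: sum_distrib_right)
qed

text \<open>Rewriting in the basis of the \<open>(n - 1) choose k\<close> turns the hypothesis into
  linear relations between the \<open>g j\<close>, which Pascal's rule brings into triangular
  form.\<close>

lemma hstar_basis_unique:
  fixes g :: "nat \<Rightarrow> real"
  assumes "\<And>n. 1 \<le> n \<Longrightarrow> (\<Sum>j\<le>d. g j * real ((n + d - j) choose d)) = 0" "j \<le> d"
  shows "g j = 0"
proof -
  have S: "(\<Sum>j\<le>d. g j * real (Suc (d - j) choose r)) = 0" if "r \<le> d" for r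
    using binomial_basis_unique[where d = d and k = "d - r"
          and f = "\<lambda>k. \<Sum>j\<le>d. g j * real (Suc (d - j) choose (d - k))"]
      assms(1) that by (simp add: hstar_to_fstar_sum)
  \<comment> \<open>Pascal's rule replaces \<open>Suc (d - j)\<close> by \<open>d - j\<close>. With
    \<open>r = d - j\<close> the terms of index above j then vanish, and those below j vanish by
    induction.\<close>
  have S': "(\<Sum>j\<le>d. g j * real ((d - j) choose r)) = 0" if "r \<le> d" for r
    using that
  proof (induction r)
    case 0
    then show ?case using S[of 0] by simp
  next
    case (Suc r)
    then show ?case using S[of "Suc r"] by (simp add: distrib_left sum.distrib)
  qed
  show ?thesis using assms(2)
  proof (induction j rule: less_induct)
    case (less j)
    have "0 = (\<Sum>i\<le>d. g i * real ((d - i) choose (d - j)))" using S'[of "d - j"] by simp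
    also have "\<dots> = (\<Sum>i\<in>{j}. g i * real ((d - i) choose (d - j)))"
      using less by (intro sum.mono_neutral_right) (auto simp: neq_iff binomial_eq_0)
    finally show ?case by simp
  qed
qed

text \<open>Evaluates the \<open>THE\<close> in \<open>hstar\<close>: the expansion at hand, cut off
  above \<open>CARD('d)\<close>, is a solution, and differences of solutions vanish by
  \<open>hstar_basis_unique\<close>.\<close>

lemma hstar_eqI:
  fixes P :: "(real ^ 'd) set"
  assumes "\<And>n. 1 \<le> n \<Longrightarrow> real (ehr P n) = (\<Sum>j\<le>CARD('d). h j * real ((n + CARD('d) - j) choose CARD('d)))"
    and "k \<le> CARD('d)"
  shows "hstar P k = h k"
proof -
  have "hstar P = (\<lambda>k. if k \<le> CARD('d) then h k else 0)"
    unfolding hstar_def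
  proof (rule the_equality)
    fix g :: "nat \<Rightarrow> real"
    assume g: "(\<forall>k>CARD('d). g k = 0) \<and> (\<forall>n\<ge>1. real (ehr P n) =
        (\<Sum>k\<le>CARD('d). g k * real ((n + CARD('d) - k) choose CARD('d))))"
    have "g k - h k = 0" if "k \<le> CARD('d)" for k
      using g assms(1) that
      by (intro hstar_basis_unique[where d = "CARD('d)" and g = "\<lambda>k. g k - h k"]) (auto simp: left_diff_distrib sum_subtractf)
    then show "g = (\<lambda>k. if k \<le> CARD('d) then h k else 0)" using g by (auto simp: fun_eq_iff)
  qed (use assms in auto)
  then show ?thesis using assms(2) by simp
qed

lemma fstar_eq_sum:
  fixes P :: "(real ^ 'd) set"
  assumes h: "\<And>n. 1 \<le> n \<Longrightarrow> real (ehr P n) = (\<Sum>j\<le>CARD('d). h j * real ((n + CARD('d) - j) choose CARD('d)))"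
    and "k \<le> CARD('d)"
  shows "fstar P k = (\<Sum>j\<le>CARD('d). h j * real (Suc (CARD('d) - j) choose (CARD('d) - k)))"
proof -
  define f where "f k = (\<Sum>j\<le>CARD('d). h j * real (Suc (CARD('d) - j) choose (CARD('d) - k)))" for k
  have f: "real (ehr P n) = (\<Sum>k\<le>CARD('d). f k * real ((n - 1) choose k))" if "1 \<le> n" for n
    unfolding f_def using h[OF that] hstar_to_fstar_sum[OF that] by simp
  have "fstar P = (\<lambda>k. if k \<le> CARD('d) then f k else 0)"
    unfolding fstar_def
  proof (rule the_equality)
    fix g :: "nat \<Rightarrow> real"
    assume g: "(\<forall>k>CARD('d). g k = 0) \<and> (\<forall>n\<ge>1. real (ehr P n) =
        (\<Sum>k\<le>CARD('d). g k * real ((n - 1) choose k)))"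
    have "g k - f k = 0" if "k \<le> CARD('d)" for k
      using g f that
      by (intro binomial_basis_unique[where d = "CARD('d)" and f = "\<lambda>k. g k - f k"]) (auto simp: left_diff_distrib sum_subtractf)
    then show "g = (\<lambda>k. if k \<le> CARD('d) then f k else 0)" using g by (auto simp: fun_eq_iff)
  qed (use f in auto)
  then show ?thesis using assms(2) by (simp add: f_def)
qed

section \<open>The strict decrease of the f*-vector\<close>

lemma hstar_eq_0_above_degree:
  fixes P :: "(real ^ 'd) set"
  assumes "polytope_degree P < k" "k \<le> CARD('d)"
  shows "hstar P k = 0"
proof -
  have "coeff (hstar_poly P) k = hstar P k"
    using assms(2) by (simp add: hstar_poly_def coeff_sum)
  then show ?thesis using assms(1) by (simp add: polytope_degree_def coeff_eq_0)
qed

text \<open>Binomial coefficients increase up to the middle. For \<open>m = 2 * r + 1\<close> the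
  two are the equal middle ones; otherwise \<open>2 * Suc r \<le> m\<close>.\<close>

lemma choose_le_choose_Suc:
  assumes "2 * r + 1 \<le> m" shows "m choose r \<le> m choose Suc r"
proof (cases "m = 2 * r + 1")
  case True
  then show ?thesis using binomial_symmetric[of r m] by simp
next
  case False
  then show ?thesis using assms by (intro binomial_mono) auto
qed

theorem theorem1p7:
  fixes P :: "(real ^ 'd) set" and s k :: nat
  assumes "lattice_polytope P"
    and "aff_dim P = int CARD('d)"
    and "polytope_degree P \<le> s"
    and "polytope_degree P \<noteq> 0"
    and "\<lceil>(real CARD('d) + real s) / 2\<rceil> \<le> int k" and "k \<le> CARD('d)"
  shows "fstar P (k - 1) > fstar P k"
proof -
  define d where "d = CARD('d)"
  obtain h where h0: "0 < h 0" and
    h: "\<And>n. 1 \<le> n \<Longrightarrow> ehr P n = (\<Sum>j\<le>CARD('d). h j * ((n + CARD('d) - j) choose CARD('d)))"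
    using ehr_hstar_expansion[OF assms(1,2)] by blast
  have h': "real (ehr P n) = (\<Sum>j\<le>CARD('d). real (h j) * real ((n + CARD('d) - j) choose CARD('d)))"
    if "1 \<le> n" for n using h[OF that] by simp
  have "real d + real s \<le> 2 * real k" using assms(5) by (simp add: d_def ceiling_le_iff)
  then have ks: "d + s \<le> 2 * k" by linarith
  \<comment> \<open>The degree is nonzero and at most s, so \<open>s \<ge> 1\<close>, which makes
    \<open>d < 2 * k\<close> strict.\<close>
  have k: "d < 2 * k" "1 \<le> k" "k \<le> d" using ks assms by (auto simp: d_def)
  have Suc_diff: "d - (k - 1) = Suc (d - k)" using k by simp
  have hz: "h j = 0" if "s < j" "j \<le> d" for j
    using hstar_eqI[of P "\<lambda>j. real (h j)" j, OF h'] hstar_eq_0_above_degree[of P j] that assms(3)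
    by (simp add: d_def)
  \<comment> \<open>For \<open>j \<le> s\<close> the bound \<open>d + s \<le> 2 * k\<close> puts
    \<open>d - k\<close> below the middle of row \<open>Suc (d - j)\<close>; for larger j both sides
    are 0.\<close>
  have le: "h j * (Suc (d - j) choose (d - k)) \<le> h j * (Suc (d - j) choose Suc (d - k))" if "j \<le> d" for j
  proof (cases "j \<le> s")
    case True
    then have "2 * (d - k) + 1 \<le> Suc (d - j)" using ks k that by linarith
    then show ?thesis by (intro mult_left_mono choose_le_choose_Suc) auto
  next
    case False
    then show ?thesis using hz that by simp
  qed
  \<comment> \<open>The term j = 0 supplies strictness: \<open>d < 2 * k\<close> means
    \<open>2 * Suc (d - k) \<le> Suc d\<close>, and \<open>h 0\<close> is positive.\<close>
  have "Suc d choose (d - k) < Suc d choose Suc (d - k)"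
    using k by (intro binomial_strict_mono) auto
  then have "h 0 * (Suc (d - 0) choose (d - k)) < h 0 * (Suc (d - 0) choose Suc (d - k))"
    using h0 by simp
  then have "(\<Sum>j\<le>d. h j * (Suc (d - j) choose (d - k))) < (\<Sum>j\<le>d. h j * (Suc (d - j) choose Suc (d - k)))"
    using le by (intro sum_strict_mono_ex1) (auto intro!: bexI[of _ 0])
  moreover have "fstar P k = real (\<Sum>j\<le>d. h j * (Suc (d - j) choose (d - k)))"
    using fstar_eq_sum[OF h', of k] k by (simp add: d_def)
  moreover have "fstar P (k - 1) = real (\<Sum>j\<le>d. h j * (Suc (d - j) choose Suc (d - k)))"
    using fstar_eq_sum[OF h', of "k - 1"] k Suc_diff by (simp add: d_def)
  ultimately show ?thesis by (simp only: of_nat_less_iff)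
qed

end
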